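(* Let $d\ge 2$, let $\mu_n\in\mathbb{R}^d$, and let $\Sigma_n\in\mathbb{R}^{d\times d}$ be symmetric positive definite with eigendecomposition $\Sigma_n=U_nD_nU_n^T$ ($U_n$ orthogonal, $D_n$ diagonal with positive entries). Let $P_n=N(\mu_n,\Sigma_n)$ be the Gaussian distribution on $\mathbb{R}^d$ with mean $\mu_n$ and covariance $\Sigma_n$. Let $w_n,w_n'\in\mathbb{R}^d$ (a sampled parameter vector and its updated value), with $w_n'\neq\mu_n$. For an invertible matrix $A\in\mathbb{R}^{d\times d}$ and $b\in\mathbb{R}^d$, let $P_{n+1}^{A,b}=N(A\mu_n+b,\,A\Sigma_nA^T)$ denote the push-forward of $P_n$ under the affine map $w\mapsto Aw+b$. Consider the problem $$\min_{A,b}\ D_{\mathrm{KL}}\big[P_{n+1}^{A,b}\,\|\,P_n\big]=\min_{A,b}\int P_{n+1}^{A,b}(w)\log\frac{P_{n+1}^{A,b}(w)}{P_n(w)}\,dw\quad\text{subject to}\quad w_n'=Aw_n+b.$$ Let $\hat\mu,\hat\nu\in\mathbb{R}^d$ be orthonormal vectors and $u,v_\parallel,v_\perp\in\mathbb{R}$ be such that $$u\hat\mu=\tfrac{1}{\sqrt{D_n}}U_n^T(w_n-\mu_n),\qquad v_\parallel\hat\mu+v_\perp\hat\nu=\tfrac{1}{\sqrt{D_n}}U_n^T(w_n'-\mu_n).$$ Then the solution $A^\ast$ of the problem is $$A^\ast=I_{d\times d}+U_n\sqrt{D_n}\left\{\bigl[\hat\mu\ \ \hat\nu\bigr]\left(A_{2\times2}-I_{2\times2}\right)\begin{bmatrix}\hat\mu^T\\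 \hat\nu^T\end{bmatrix}\right\}\frac{1}{\sqrt{D_n}}U_n^T,$$ where, writing $V=v_\parallel^2+v_\perp^2$ and $c=\dfrac{u\sqrt{V}+\delta_1\sqrt{4+u^2(4+V)}}{2(1+u^2)}$, $$A_{2\times2}=\frac{1}{\sqrt{V}}\begin{bmatrix}c\,v_\parallel & -\delta_2 v_\perp\\ c\,v_\perp & \delta_2 v_\parallel\end{bmatrix}$$ for some $\delta_1,\delta_2\in\{-1,+1\}$. The hyperparameters of the corresponding posterior $P_{n+1}=N(\mu_{n+1},\Sigma_{n+1})$ are $$\Sigma_{n+1}=A^\ast\Sigma_nA^{\ast T},\qquad \mu_{n+1}=A^\ast(\mu_n-w_n)+w_n'.$$
   Context: $\sqrt{D_n}$ and $\frac{1}{\sqrt{D_n}}$ denote the diagonal matrices whose entries are the square roots (resp. reciprocal square roots) of the diagonal entries of $D_n$. $[\hat\mu\ \hat\nu]$ is the $d\times 2$ matrix with columns $\hat\mu,\hat\nu$. $D_{\mathrm{KL}}$ is the Kullback–Leibler divergence. *)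

theory Defs
  imports "HOL-Analysis.Analysis"
begin

text \<open>Density of the multivariate Gaussian N(mu, Sigma) on real^'n (Sigma symmetric positive definite).\<close>
definition gauss_pdf :: "real^'n \<Rightarrow> real^'n^'n \<Rightarrow> real^'n \<Rightarrow> real" where
  "gauss_pdf mu S w =
     exp (- (1/2) * ((w - mu) \<bullet> (matrix_inv S *v (w - mu))))
       / sqrt ((2 * pi) ^ CARD('n) * det S)"

text \<open>KL divergence between densities p and q w.r.t. Lebesgue measure, as in the paper:
  integral of p(w) log(p(w)/q(w)) dw.\<close>
definition KL_dens :: "('a::euclidean_space \<Rightarrow> real) \<Rightarrow> ('a \<Rightarrow> real) \<Rightarrow> real" where
  "KL_dens p q = (\<integral>w. p w * ln (p w / q w) \<partial>lborel)"

text \<open>KL[ P^{A,b}_{n+1} || P_n ] where P_n = N(mu,S), P^{A,b}_{n+1} = N(A mu + b, A S A^T).\<close>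
definition KL_affine :: "real^'n \<Rightarrow> real^'n^'n \<Rightarrow> real^'n^'n \<Rightarrow> real^'n \<Rightarrow> real" where
  "KL_affine mu S A b = KL_dens (gauss_pdf (A *v mu + b) (A ** S ** transpose A)) (gauss_pdf mu S)"

definition diag_mat :: "real^'n \<Rightarrow> real^'n^'n" where
  "diag_mat d = (\<chi> i j. if i = j then d $ i else 0)"

definition sym_posdef :: "real^'n^'n \<Rightarrow> bool" where
  "sym_posdef S \<longleftrightarrow> transpose S = S \<and> (\<forall>x. x \<noteq> 0 \<longrightarrow> x \<bullet> (S *v x) > 0)"

end

theory Submission
  imports Defs "HOL-Probability.Probability"
begin

(* Whitening w = mu + T x with T = U sqrt(D) turns P_n into N(0, I) and the candidate P^{A,b} into
   N(y, B B^T) with B = T^-1 A T, and the constraint w' = A w + b forces y = z - u B muh, where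
   z = vpar muh + vperp nuh.  By the Gaussian KL formula, 2 KL + d = |B|_F^2 + |z - u B muh|^2 - 2 ln |det B|.
   With rho = |B muh|, Gibbs' inequality applied after dilating B by 1/rho along muh gives
   |B|_F^2 - 2 ln |det B| >= d - 1 + rho^2 - 2 ln rho, and Cauchy-Schwarz bounds the middle term; what
   remains is a function of rho alone, minimised where (1 + u^2) rho^2 - |u| sqrt V rho - 1 = 0, i.e. at
   rho = |c|.  The matrix I + [muh nuh] (A2 - I) [muh nuh]^T, a dilation by c along muh followed by a
   rotation of the muh-nuh plane taking muh to z / |z|, attains all these bounds at once. *)

section \<open>Linear change of variables for Lebesgue measure\<close>

lemma lborel_eq_density_distr_of_measure_image:
  fixes f :: "'a::euclidean_space \<Rightarrow> 'a"
  assumes f: "linear f" "inj f"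
    and image: "\<And>a b. measure lebesgue (f ` cbox a b) = r * measure lebesgue (cbox a b)"
  shows "lborel = density (distr lborel borel f) (\<lambda>_. ennreal r)"
proof (rule lborel_eqI)
  fix l u :: 'a
  assume le: "\<And>b. b \<in> Basis \<Longrightarrow> l \<bullet> b \<le> u \<bullet> b"
  have cont: "continuous_on UNIV f"
    using f(1) by (intro linear_continuous_on) (simp add: linear_conv_bounded_linear)
  then have [measurable]: "f \<in> borel_measurable borel"
    by (rule borel_measurable_continuous_onI)
  obtain g where g: "linear g" "\<And>x. g (f x) = x"
    using linear_injective_left_inverse[OF f] by (metis comp_apply id_apply)
  have surj: "surj f"
    using linear_injective_imp_surjective[OF f] by simp
  let ?P = "f -` box l u"
  have "f (g y) = y" for y
    using surj g(2) by (metis surjD)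
  then have "?P = g ` box l u"
    using g(2) by (auto simp: image_iff) (metis vimageI)
  then have "bounded ?P"
    using g(1) by (simp add: bounded_linear_image linear_linear)
  moreover have "open ?P"
    using cont by (intro open_vimage) (simp_all add: open_box)
  ultimately have P: "?P \<in> lmeasurable"
    by (rule lmeasurable_open)
  have "emeasure lborel ?P = emeasure lebesgue ?P"
    using \<open>open ?P\<close> by (simp add: emeasure_completion borel_open)
  also have "\<dots> = measure lebesgue ?P"
    using P by (rule emeasure_eq_measure2)
  finally have emeasure_P: "emeasure lborel ?P = measure lebesgue ?P" .
  have "r * measure lebesgue ?P = measure lebesgue (box l u)"
    using measure_linear_sufficient[OF f(1) P image] surj by (metis surj_image_vimage_eq)
  moreover have "r \<ge> 0"
    using image[of 0 One] measure_nonneg[of lebesgue "f ` cbox 0 One"] by simp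
  ultimately show "emeasure (density (distr lborel borel f) (\<lambda>_. ennreal r)) (box l u)
      = (\<Prod>b\<in>Basis. (u - l) \<bullet> b)"
    using le emeasure_P
    by (simp add: emeasure_density nn_integral_cmult_indicator emeasure_distr
        ennreal_mult[symmetric] measure_completion)
qed simp

lemma lborel_eq_density_distr_comp:
  fixes f g :: "real^'n \<Rightarrow> real^'n"
  assumes lin: "linear f" "linear g"
    and f: "lborel = density (distr lborel borel f) (\<lambda>_. ennreal \<bar>det (matrix f)\<bar>)"
    and g: "lborel = density (distr lborel borel g) (\<lambda>_. ennreal \<bar>det (matrix g)\<bar>)"
  shows "lborel = density (distr lborel borel (f \<circ> g)) (\<lambda>_. ennreal \<bar>det (matrix (f \<circ> g))\<bar>)"
proof -
  have [measurable]: "f \<in> borel_measurable borel" "g \<in> borel_measurable borel"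
    using lin by (auto intro!: borel_measurable_continuous_onI linear_continuous_on
        simp: linear_conv_bounded_linear)
  have "lborel = density (distr (density (distr lborel borel g) (\<lambda>_. ennreal \<bar>det (matrix g)\<bar>))
      borel f) (\<lambda>_. ennreal \<bar>det (matrix f)\<bar>)"
    using f g by simp
  also have "distr (density (distr lborel borel g) (\<lambda>_. ennreal \<bar>det (matrix g)\<bar>)) borel f
      = density (distr lborel borel (f \<circ> g)) (\<lambda>_. ennreal \<bar>det (matrix g)\<bar>)"
    by (simp add: density_distr distr_distr)
  also have "density \<dots> (\<lambda>_. ennreal \<bar>det (matrix f)\<bar>)
      = density (distr lborel borel (f \<circ> g)) (\<lambda>_. ennreal \<bar>det (matrix (f \<circ> g))\<bar>)"
    using matrix_compose[OF lin(2,1)]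
    by (simp add: density_density_eq det_mul abs_mult ennreal_mult' mult.commute)
  finally show ?thesis .
qed

lemma measure_coordinate_swap_cbox:
  fixes a b :: "real^'n"
  shows "measure lebesgue ((\<lambda>x. \<chi> i. x $ Transposition.transpose m n i) ` cbox a b)
    = measure lebesgue (cbox a b)"
proof (cases "cbox a b = {}")
  case False
  let ?h = "\<lambda>x::real^'n. \<chi> i. x $ Transposition.transpose m n i"
  have "?h ` cbox a b = cbox (?h a) (?h b)"
    by (auto simp: image_iff lambda_swap_Galois mem_box_cart) (metis transpose_involutory)+
  moreover have "?h ` cbox a b \<noteq> {}"
    using False by blast
  ultimately show ?thesis
    using False prod.permute[OF permutes_swap_id, where S=UNIV and g="\<lambda>i. (b - a) $ i", symmetric]
    by (simp add: content_cbox_cart)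
qed simp

lemma measure_shear_cbox:
  fixes a b :: "real^'n"
  assumes "m \<noteq> n"
  shows "measure lebesgue ((\<lambda>x. \<chi> i. if i = m then x $ m + x $ n else x $ i) ` cbox a b)
    = measure lebesgue (cbox a b)"
proof (cases "cbox a b = {}")
  case False
  let ?h = "\<lambda>x::real^'n. \<chi> i. if i = m then x $ m + x $ n else x $ i"
    and ?v = "\<chi> i. if i = n then - a $ n else 0"
  have "?h ` cbox a b = (+) (\<chi> i. if i = m \<or> i = n then a $ n else 0) ` ?h ` cbox (?v + a) (?v + b)"
    using assms unfolding cbox_translation image_comp o_def by (force simp: vec_eq_iff)
  then have "measure lebesgue (?h ` cbox a b) = measure lebesgue (?h ` cbox (?v + a) (?v + b))"
    by (simp only: measure_translation)
  also have "\<dots> = measure lebesgue (cbox (?v + a) (?v + b))"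
    using assms False by (intro measure_shear_interval) (auto simp: cbox_translation)
  also have "\<dots> = measure lebesgue (cbox a b)"
    by (metis cbox_translation measure_translation)
  finally show ?thesis .
qed simp

lemma abs_det_matrix_coordinate_swap:
  "\<bar>det (matrix (\<lambda>x::real^'n. \<chi> i. x $ Transposition.transpose m n i))\<bar> = 1"
proof -
  have "(\<chi> i j. if Transposition.transpose m n i = j then 1 else 0)
      = (\<chi> i j. if j = Transposition.transpose m n i then 1 else (0::real))"
    by (auto intro!: Cart_lambda_cong)
  then have "matrix (\<lambda>x::real^'n. \<chi> i. x $ Transposition.transpose m n i)
      = transpose (\<chi> i j. mat 1 $ i $ Transposition.transpose m n j)"
    by (auto simp: matrix_eq transpose_def axis_def mat_def matrix_def)
  then show ?thesis
    by (simp add: det_permute_columns permutes_swap_id sign_swap_id abs_mult)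
qed

lemma det_matrix_shear:
  assumes "m \<noteq> n"
  shows "det (matrix (\<lambda>x::real^'n. \<chi> i. if i = m then x $ m + x $ n else x $ i)) = 1"
proof -
  have "matrix (\<lambda>x::real^'n. \<chi> i. if i = m then x $ m + x $ n else x $ i)
      = (\<chi> k. if k = m then row m (mat 1) + 1 *s row n (mat 1) else row k (mat 1))"
    by (auto simp: matrix_def axis_def row_def mat_def vec_eq_iff)
  then show ?thesis
    using det_row_operation[OF assms, of "mat 1 :: real^'n^'n" 1] by simp
qed

(* Change_Of_Vars proves measure_linear_image only for index types of sort wellorder. *)
lemma lborel_eq_density_distr_linear:
  fixes f :: "real^'n \<Rightarrow> real^'n"
  assumes "linear f" and "det (matrix f) \<noteq> 0"
  shows "lborel = density (distr lborel borel f) (\<lambda>_. ennreal \<bar>det (matrix f)\<bar>)"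
proof -
  let ?Q = "\<lambda>f. lborel = density (distr lborel borel f) (\<lambda>_. ennreal \<bar>det (matrix f)\<bar>)"
  have from_image: "det (matrix f) \<noteq> 0 \<longrightarrow> ?Q f"
    if "linear f" "\<And>a b. measure lebesgue (f ` cbox a b) = \<bar>det (matrix f)\<bar> * measure lebesgue (cbox a b)"
    for f :: "real^'n \<Rightarrow> real^'n"
    using that by (auto intro: lborel_eq_density_distr_of_measure_image simp: det_nz_iff_inj)
  have "det (matrix f) \<noteq> 0 \<longrightarrow> ?Q f"
  proof (rule induct_linear_elementary[OF \<open>linear f\<close>])
    fix f g :: "real^'n \<Rightarrow> real^'n"
    assume lin: "linear f" "linear g"
      and IH: "det (matrix f) \<noteq> 0 \<longrightarrow> ?Q f" "det (matrix g) \<noteq> 0 \<longrightarrow> ?Q g"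
    show "det (matrix (f \<circ> g)) \<noteq> 0 \<longrightarrow> ?Q (f \<circ> g)"
    proof
      assume "det (matrix (f \<circ> g)) \<noteq> 0"
      then have "det (matrix f) \<noteq> 0" "det (matrix g) \<noteq> 0"
        using matrix_compose[OF lin(2,1)] by (auto simp: det_mul)
      then show "?Q (f \<circ> g)"
        using lin IH by (intro lborel_eq_density_distr_comp) auto
    qed
  next
    fix f :: "real^'n \<Rightarrow> real^'n" and i
    assume "linear f" "\<And>x. f x $ i = 0"
    then have "\<not> inj f"
      by (metis linear_injective_imp_surjective one_neq_zero surjE vec_component)
    then show "det (matrix f) \<noteq> 0 \<longrightarrow> ?Q f"
      using \<open>linear f\<close> det_nz_iff_inj by blast
  next
    fix c :: "'n \<Rightarrow> real"
    have "det (matrix (\<lambda>x::real^'n. \<chi> i. c i * x $ i)) = prod c UNIV"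
      by (simp add: matrix_def axis_def det_diagonal)
    then show "det (matrix (\<lambda>x::real^'n. \<chi> i. c i * x $ i)) \<noteq> 0 \<longrightarrow> ?Q (\<lambda>x. \<chi> i. c i * x $ i)"
      by (intro from_image linearI) (simp_all add: vec_eq_iff algebra_simps measure_stretch)
  next
    fix m n :: 'n
    let ?h = "\<lambda>x::real^'n. \<chi> i. x $ Transposition.transpose m n i"
    show "det (matrix ?h) \<noteq> 0 \<longrightarrow> ?Q ?h"
      using abs_det_matrix_coordinate_swap[of m n]
      by (intro from_image linearI) (simp_all add: measure_coordinate_swap_cbox vec_eq_iff)
  next
    fix m n :: 'n
    assume "m \<noteq> n"
    let ?h = "\<lambda>x::real^'n. \<chi> i. if i = m then x $ m + x $ n else x $ i"
    show "det (matrix ?h) \<noteq> 0 \<longrightarrow> ?Q ?h"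
      using \<open>m \<noteq> n\<close> det_matrix_shear[of m n]
      by (intro from_image linearI) (auto simp: measure_shear_cbox vec_eq_iff algebra_simps)
  qed
  with assms show ?thesis
    by blast
qed

lemma lborel_eq_density_distr_affine:
  fixes M :: "real^'n^'n" and t :: "real^'n"
  assumes "det M \<noteq> 0"
  shows "lborel = density (distr lborel borel (\<lambda>x. t + M *v x)) (\<lambda>_. ennreal \<bar>det M\<bar>)"
proof -
  have lin: "lborel = density (distr lborel borel ((*v) M)) (\<lambda>_. ennreal \<bar>det M\<bar>)"
    using lborel_eq_density_distr_linear[of "(*v) M"] assms
    by (simp add: matrix_vector_mul_linear matrix_of_matrix_vector_mul)
  have [measurable]: "(*v) M \<in> borel_measurable borel"
    by (intro borel_measurable_continuous_onI linear_continuous_on matrix_vector_mul_bounded_linear)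
  have "lborel = distr lborel borel ((+) t)"
    by (simp add: lborel_distr_plus)
  also have "\<dots> = distr (density (distr lborel borel ((*v) M)) (\<lambda>_. ennreal \<bar>det M\<bar>)) borel ((+) t)"
    by (subst lin) (rule refl)
  also have "\<dots> = density (distr lborel borel (\<lambda>x. t + M *v x)) (\<lambda>_. ennreal \<bar>det M\<bar>)"
    by (simp add: density_distr distr_distr comp_def)
  finally show ?thesis .
qed

lemma borel_measurable_affine_cart [measurable]:
  fixes M :: "real^'n^'m" and t :: "real^'m"
  shows "(\<lambda>x. t + M *v x) \<in> borel_measurable borel"
  by (intro borel_measurable_continuous_onI continuous_intros linear_continuous_on
      matrix_vector_mul_bounded_linear)

lemma integrable_lborel_affine_iff:
  fixes M :: "real^'n^'n" and f :: "real^'n \<Rightarrow> real"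
  assumes "det M \<noteq> 0" and [measurable]: "f \<in> borel_measurable borel"
  shows "integrable lborel (\<lambda>x. f (t + M *v x)) \<longleftrightarrow> integrable lborel f"
proof -
  have "integrable lborel f \<longleftrightarrow>
      integrable (density (distr lborel borel (\<lambda>x. t + M *v x)) (\<lambda>_. ennreal \<bar>det M\<bar>)) f"
    by (subst lborel_eq_density_distr_affine[OF assms(1), symmetric]) (rule refl)
  also have "\<dots> \<longleftrightarrow> integrable lborel (\<lambda>x. \<bar>det M\<bar> *\<^sub>R f (t + M *v x))"
    by (simp add: integrable_density integrable_distr_eq)
  finally show ?thesis
    using assms(1) by simp
qed

lemma integral_lborel_affine:
  fixes M :: "real^'n^'n" and f :: "real^'n \<Rightarrow> real"
  assumes "det M \<noteq> 0" and [measurable]: "f \<in> borel_measurable borel"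
  shows "(\<integral>x. f x \<partial>lborel) = \<bar>det M\<bar> * (\<integral>x. f (t + M *v x) \<partial>lborel)"
proof -
  have "(\<integral>x. f x \<partial>lborel)
      = (\<integral>x. f x \<partial>density (distr lborel borel (\<lambda>x. t + M *v x)) (\<lambda>_. ennreal \<bar>det M\<bar>))"
    by (subst lborel_eq_density_distr_affine[OF assms(1), symmetric]) (rule refl)
  also have "\<dots> = (\<integral>x. \<bar>det M\<bar> *\<^sub>R f (t + M *v x) \<partial>lborel)"
    by (simp add: integral_density integral_distr)
  finally show ?thesis
    by simp
qed

section \<open>The standard Gaussian density on real^n\<close>

lemma
  fixes g :: "'n::finite \<Rightarrow> real \<Rightarrow> real"
  assumes int: "\<And>i. integrable lborel (g i)"
  shows integrable_lborel_prod_cart: "integrable lborel (\<lambda>x::real^'n. \<Prod>i\<in>UNIV. g i (x $ i))"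
    and integral_lborel_prod_cart:
      "(\<integral>x. (\<Prod>i\<in>UNIV. g i (x $ i)) \<partial>(lborel::(real^'n) measure)) = (\<Prod>i\<in>UNIV. \<integral>t. g i t \<partial>lborel)"
proof -
  define G where "G b = g (SOME i. b = axis i (1::real))" for b :: "real^'n"
  have G_axis: "G (axis i 1) = g i" for i
    unfolding G_def by (rule arg_cong[where f=g], rule some_equality) (auto simp: axis_eq_axis)
  have inj_axis: "inj (\<lambda>i::'n. axis i (1::real))"
    by (auto simp: inj_on_def axis_eq_axis)
  have Basis_cart: "(Basis :: (real^'n) set) = range (\<lambda>i. axis i 1)"
    by (auto simp: Basis_vec_def)
  have prod_Basis: "(\<Prod>b\<in>Basis. h b) = (\<Prod>i\<in>UNIV. h (axis i 1))" for h :: "real^'n \<Rightarrow> real"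
    unfolding Basis_cart by (rule prod.reindex[OF inj_axis, unfolded comp_def])
  have prod_eq: "(\<Prod>i\<in>UNIV. g i (x $ i)) = (\<Prod>b\<in>Basis. G b (x \<bullet> b))" for x :: "real^'n"
    by (simp add: prod_Basis G_axis inner_axis)
  have [measurable]: "G b \<in> borel_measurable borel" and intG: "integrable lborel (G b)" for b
    unfolding G_def using int by (auto intro: borel_measurable_integrable)
  interpret product_sigma_finite "\<lambda>_::real^'n. (lborel :: real measure)"
    by (simp add: product_sigma_finite_def sigma_finite_lborel)
  have coords: "(\<Prod>b\<in>Basis. G b ((\<Sum>b\<in>Basis. f b *\<^sub>R b) \<bullet> b)) = (\<Prod>b\<in>Basis. G b (f b))" for f
    by (intro prod.cong refl) (simp add: inner_sum_left inner_Basis if_distrib cong: if_cong)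
  show "integrable lborel (\<lambda>x::real^'n. \<Prod>i\<in>UNIV. g i (x $ i))"
    unfolding prod_eq
    by (subst lborel_eq, subst integrable_distr_eq)
      (auto simp: coords intro!: product_integrable_prod intG)
  have "(\<integral>x. (\<Prod>i\<in>UNIV. g i (x $ i)) \<partial>(lborel::(real^'n) measure))
      = (\<integral>f. (\<Prod>b\<in>Basis. G b ((\<Sum>b\<in>Basis. f b *\<^sub>R b) \<bullet> b)) \<partial>(\<Pi>\<^sub>M b\<in>Basis. lborel))"
    unfolding prod_eq by (subst lborel_eq) (rule integral_distr; measurable)
  also have "\<dots> = (\<Prod>b\<in>Basis. \<integral>t. G b t \<partial>lborel)"
    unfolding coords by (rule product_integral_prod) (auto intro: intG)
  also have "\<dots> = (\<Prod>i\<in>UNIV. \<integral>t. g i t \<partial>lborel)"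
    by (simp add: prod_Basis G_axis)
  finally show "(\<integral>x. (\<Prod>i\<in>UNIV. g i (x $ i)) \<partial>(lborel::(real^'n) measure))
      = (\<Prod>i\<in>UNIV. \<integral>t. g i t \<partial>lborel)" .
qed

definition std_normal_density_cart :: "real^'n \<Rightarrow> real" where
  "std_normal_density_cart x = (\<Prod>i\<in>UNIV. std_normal_density (x $ i))"

lemma std_normal_density_cart_eq:
  "std_normal_density_cart (x::real^'n) = exp (- (x \<bullet> x) / 2) / sqrt ((2 * pi) ^ CARD('n))"
proof -
  have "std_normal_density_cart x = (\<Prod>i\<in>UNIV. (1 / sqrt (2 * pi)) * exp (- (x $ i)\<^sup>2 / 2))"
    by (simp only: std_normal_density_cart_def std_normal_density_def)
  also have "\<dots> = (1 / sqrt (2 * pi)) ^ CARD('n) * exp (\<Sum>i\<in>UNIV. - (x $ i)\<^sup>2 / 2)"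
    unfolding prod.distrib prod_constant by (simp add: exp_sum)
  also have "(\<Sum>i\<in>UNIV. - (x $ i)\<^sup>2 / 2) = - (x \<bullet> x) / 2"
    by (simp add: inner_vec_def sum_negf sum_divide_distrib power2_eq_square)
  finally show ?thesis
    by (simp add: real_sqrt_power[symmetric] power_divide)
qed

lemma std_normal_density_cart_pos: "std_normal_density_cart x > 0"
  by (simp add: std_normal_density_cart_eq)

lemma borel_measurable_std_normal_density_cart [measurable]:
  "std_normal_density_cart \<in> borel_measurable borel"
  unfolding std_normal_density_cart_eq[abs_def] by measurable

lemma
  fixes e :: "'n::finite \<Rightarrow> nat"
  shows integrable_std_normal_density_cart_monomial:
      "integrable lborel (\<lambda>x::real^'n. std_normal_density_cart x * (\<Prod>i\<in>UNIV. (x $ i) ^ e i))"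
    and integral_std_normal_density_cart_monomial:
      "(\<integral>x. std_normal_density_cart x * (\<Prod>i\<in>UNIV. (x $ i) ^ e i) \<partial>lborel)
        = (\<Prod>i\<in>UNIV. \<integral>t. std_normal_density t * t ^ e i \<partial>lborel)"
proof -
  have eq: "std_normal_density_cart x * (\<Prod>i\<in>UNIV. (x $ i) ^ e i)
      = (\<Prod>i\<in>UNIV. std_normal_density (x $ i) * (x $ i) ^ e i)" for x :: "real^'n"
    by (simp add: std_normal_density_cart_def prod.distrib)
  show "integrable lborel (\<lambda>x::real^'n. std_normal_density_cart x * (\<Prod>i\<in>UNIV. (x $ i) ^ e i))"
    unfolding eq by (intro integrable_lborel_prod_cart integrable_std_normal_moment)
  show "(\<integral>x. std_normal_density_cart x * (\<Prod>i\<in>UNIV. (x $ i) ^ e i) \<partial>lborel)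
      = (\<Prod>i\<in>UNIV. \<integral>t. std_normal_density t * t ^ e i \<partial>lborel)"
    unfolding eq by (intro integral_lborel_prod_cart integrable_std_normal_moment)
qed

lemma
  fixes j k :: "'n::finite"
  shows integrable_std_normal_density_cart: "integrable lborel (std_normal_density_cart :: real^'n \<Rightarrow> real)"
    and integral_std_normal_density_cart: "(\<integral>x. std_normal_density_cart (x::real^'n) \<partial>lborel) = 1"
    and integrable_std_normal_density_cart_moment1:
      "integrable lborel (\<lambda>x::real^'n. std_normal_density_cart x * x $ j)"
    and integral_std_normal_density_cart_moment1:
      "(\<integral>x. std_normal_density_cart (x::real^'n) * x $ j \<partial>lborel) = 0"
    and integrable_std_normal_density_cart_moment2:
      "integrable lborel (\<lambda>x::real^'n. std_normal_density_cart x * (x $ j * x $ k))"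
    and integral_std_normal_density_cart_moment2:
      "(\<integral>x. std_normal_density_cart (x::real^'n) * (x $ j * x $ k) \<partial>lborel) = (if j = k then 1 else 0)"
proof -
  let ?\<delta> = "\<lambda>j i. if i = j then 1 else 0 :: nat"
  let ?m = "\<lambda>n. \<integral>t. std_normal_density t * t ^ n \<partial>lborel"
  have m: "?m 0 = 1" "(\<integral>t. std_normal_density t * t \<partial>lborel) = 0"
    "(\<integral>t. std_normal_density t * (t * t) \<partial>lborel) = 1"
    using integral_std_normal_moment_odd[of 0] integral_std_normal_moment_even[of 1] by (simp_all add: power2_eq_square)
  have \<delta>: "(\<Prod>i\<in>UNIV. (x $ i) ^ ?\<delta> j i) = x $ j" for j and x :: "real^'n"
    by (simp add: if_distrib[of "power _"] prod.If_cases)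
  have eq1: "std_normal_density_cart x * x $ j = std_normal_density_cart x * (\<Prod>i\<in>UNIV. (x $ i) ^ ?\<delta> j i)"
    and eq2: "std_normal_density_cart x * (x $ j * x $ k)
      = std_normal_density_cart x * (\<Prod>i\<in>UNIV. (x $ i) ^ (?\<delta> j i + ?\<delta> k i))" for x :: "real^'n"
    by (simp_all only: \<delta> power_add prod.distrib power_0 prod.neutral_const)
  show "integrable lborel (std_normal_density_cart :: real^'n \<Rightarrow> real)"
    using integrable_std_normal_density_cart_monomial[of "\<lambda>_::'n. 0"] by simp
  show "integrable lborel (\<lambda>x::real^'n. std_normal_density_cart x * x $ j)"
    "integrable lborel (\<lambda>x::real^'n. std_normal_density_cart x * (x $ j * x $ k))"
    unfolding eq1 eq2 by (rule integrable_std_normal_density_cart_monomial)+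
  show "(\<integral>x. std_normal_density_cart (x::real^'n) \<partial>lborel) = 1"
    using integral_std_normal_density_cart_monomial[of "\<lambda>_::'n. 0"] m by simp
  have "(\<Prod>i\<in>UNIV. ?m (?\<delta> j i)) = 0"
    by (rule prod_zero) (auto simp: m)
  then show "(\<integral>x. std_normal_density_cart (x::real^'n) * x $ j \<partial>lborel) = 0"
    by (subst eq1) (simp only: integral_std_normal_density_cart_monomial)
  have "(\<Prod>i\<in>UNIV. ?m (?\<delta> j i + ?\<delta> k i)) = (if j = k then 1 else 0)"
    by (cases "j = k") (auto intro!: prod.neutral prod_zero simp: m)
  then show "(\<integral>x. std_normal_density_cart (x::real^'n) * (x $ j * x $ k) \<partial>lborel) = (if j = k then 1 else 0)"
    by (subst eq2) (simp only: integral_std_normal_density_cart_monomial)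
qed

definition frobenius_sq :: "real^'n^'m \<Rightarrow> real" where
  "frobenius_sq B = (\<Sum>i\<in>UNIV. \<Sum>j\<in>UNIV. (B $ i $ j)\<^sup>2)"

lemma frobenius_sq_mat_1: "frobenius_sq (mat 1 :: real^'n^'n) = real CARD('n)"
  by (simp add: frobenius_sq_def mat_def if_distrib[of "\<lambda>x. x\<^sup>2"] cong: if_cong)

lemma
  fixes B :: "real^'n^'m" and y :: "real^'m"
  shows integrable_std_normal_density_cart_quadratic:
      "integrable lborel (\<lambda>x. std_normal_density_cart x * ((y + B *v x) \<bullet> (y + B *v x)))"
    and integral_std_normal_density_cart_quadratic:
      "(\<integral>x. std_normal_density_cart x * ((y + B *v x) \<bullet> (y + B *v x)) \<partial>lborel) = y \<bullet> y + frobenius_sq B"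
proof -
  let ?\<phi> = "std_normal_density_cart :: real^'n \<Rightarrow> real"
  have square: "(a + (\<Sum>j\<in>UNIV. b j)) * (a + (\<Sum>j\<in>UNIV. b j))
      = a\<^sup>2 + (\<Sum>j\<in>UNIV. 2 * a * b j) + (\<Sum>j\<in>UNIV. \<Sum>k\<in>UNIV. b j * b k)"
    for a :: real and b :: "'n \<Rightarrow> real"
    by (simp add: algebra_simps power2_eq_square sum_distrib_left sum_distrib_right sum_product)
  have expand: "?\<phi> x * ((y + B *v x) \<bullet> (y + B *v x)) =
      (\<Sum>i\<in>UNIV. (y $ i)\<^sup>2 * ?\<phi> x + (\<Sum>j\<in>UNIV. (2 * y $ i * B $ i $ j) * (?\<phi> x * x $ j))
        + (\<Sum>j\<in>UNIV. \<Sum>k\<in>UNIV. (B $ i $ j * B $ i $ k) * (?\<phi> x * (x $ j * x $ k))))" for x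
    unfolding inner_vec_def matrix_vector_mult_def
    by (simp add: square sum_distrib_left algebra_simps power2_eq_square)
  show "integrable lborel (\<lambda>x. ?\<phi> x * ((y + B *v x) \<bullet> (y + B *v x)))"
    unfolding expand
    by (simp add: integrable_std_normal_density_cart integrable_std_normal_density_cart_moment1
        integrable_std_normal_density_cart_moment2)
  have "(\<integral>x. ?\<phi> x * ((y + B *v x) \<bullet> (y + B *v x)) \<partial>lborel)
      = (\<Sum>i\<in>UNIV. (y $ i)\<^sup>2 + (\<Sum>j\<in>UNIV. \<Sum>k\<in>UNIV. B $ i $ j * B $ i $ k * (if j = k then 1 else 0)))"
    unfolding expand
    by (simp add: integral_sum integrable_sum integral_add integrable_std_normal_density_cart
        integrable_std_normal_density_cart_moment1 integrable_std_normal_density_cart_moment2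
        integral_std_normal_density_cart integral_std_normal_density_cart_moment1
        integral_std_normal_density_cart_moment2
        del: mult_zero_right)
  also have "\<dots> = y \<bullet> y + frobenius_sq B"
    by (simp add: frobenius_sq_def inner_vec_def sum.distrib power2_eq_square if_distrib cong: if_cong)
  finally show "(\<integral>x. ?\<phi> x * ((y + B *v x) \<bullet> (y + B *v x)) \<partial>lborel) = y \<bullet> y + frobenius_sq B" .
qed

section \<open>Gaussian densities and their KL divergence\<close>

lemma
  fixes A :: "real^'n^'n"
  assumes "invertible A"
  shows matrix_inv_right: "A ** matrix_inv A = mat 1"
    and matrix_inv_left: "matrix_inv A ** A = mat 1"
proof -
  have "\<exists>A'. A ** A' = mat 1 \<and> A' ** A = mat 1"
    using assms unfolding invertible_def by blast
  then have "A ** matrix_inv A = mat 1 \<and> matrix_inv A ** A = mat 1"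
    unfolding matrix_inv_def by (rule someI_ex)
  then show "A ** matrix_inv A = mat 1" "matrix_inv A ** A = mat 1"
    by auto
qed

lemma matrix_inv_unique:
  fixes X Y :: "real^'n^'n"
  assumes "X ** Y = mat 1" "Y ** X = mat 1"
  shows "matrix_inv X = Y"
proof -
  have "invertible X"
    using assms unfolding invertible_def by blast
  have "matrix_inv X = matrix_inv X ** (X ** Y)"
    using assms(1) by simp
  also have "\<dots> = (matrix_inv X ** X) ** Y"
    by (simp add: matrix_mul_assoc)
  also have "\<dots> = Y"
    using matrix_inv_left[OF \<open>invertible X\<close>] by simp
  finally show ?thesis .
qed

lemma
  fixes L :: "real^'n^'n"
  assumes "det L \<noteq> 0"
  shows matrix_inv_mult_vec_cancel: "matrix_inv L *v (L *v x) = x"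
    and mult_vec_matrix_inv_cancel: "L *v (matrix_inv L *v x) = x"
  using matrix_inv_left[of L] matrix_inv_right[of L] assms
  by (simp_all add: invertible_det_nz matrix_vector_mul_assoc)

lemma inner_transpose_mult_vec:
  fixes A :: "real^'n^'m"
  shows "a \<bullet> (transpose A *v b) = (A *v a) \<bullet> b"
  by (metis dot_lmul_matrix inner_commute transpose_matrix_vector)

lemma gauss_pdf_factor:
  fixes L :: "real^'n^'n"
  assumes "det L \<noteq> 0"
  shows "gauss_pdf m (L ** transpose L) w = std_normal_density_cart (matrix_inv L *v (w - m)) / \<bar>det L\<bar>"
proof -
  have inv: "invertible L"
    using assms invertible_det_nz by blast
  let ?N = "matrix_inv L"
  have "matrix_inv (L ** transpose L) = transpose ?N ** ?N"
  proof (rule matrix_inv_unique)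
    show "L ** transpose L ** (transpose ?N ** ?N) = mat 1"
      using matrix_inv_left[OF inv] matrix_inv_right[OF inv]
      by (metis matrix_mul_assoc matrix_mul_lid matrix_transpose_mul transpose_mat)
    show "transpose ?N ** ?N ** (L ** transpose L) = mat 1"
      using matrix_inv_left[OF inv] matrix_inv_right[OF inv]
      by (metis matrix_mul_assoc matrix_mul_lid matrix_transpose_mul transpose_mat)
  qed
  then have "(w - m) \<bullet> (matrix_inv (L ** transpose L) *v (w - m)) = (?N *v (w - m)) \<bullet> (?N *v (w - m))"
    by (simp only: matrix_vector_mul_assoc[symmetric] inner_transpose_mult_vec)
  moreover have "sqrt ((2 * pi) ^ CARD('n) * det (L ** transpose L)) = sqrt ((2 * pi) ^ CARD('n)) * \<bar>det L\<bar>"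
    by (simp add: det_mul real_sqrt_mult)
  ultimately show ?thesis
    unfolding gauss_pdf_def std_normal_density_cart_eq by simp
qed

lemma borel_measurable_gauss_pdf [measurable]:
  fixes L :: "real^'n^'n"
  assumes "det L \<noteq> 0"
  shows "gauss_pdf m (L ** transpose L) \<in> borel_measurable borel"
proof -
  have [measurable]: "(\<lambda>w. matrix_inv L *v (w - m)) \<in> borel_measurable borel"
    using borel_measurable_affine_cart[of "- (matrix_inv L *v m)" "matrix_inv L"]
    by (simp add: matrix_vector_mult_diff_distrib)
  show ?thesis
    unfolding gauss_pdf_factor[OF assms, abs_def] by measurable
qed

lemma gauss_pdf_pos:
  fixes L :: "real^'n^'n"
  assumes "det L \<noteq> 0"
  shows "gauss_pdf m (L ** transpose L) w > 0"
  using assms by (simp add: gauss_pdf_factor std_normal_density_cart_pos)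

lemma
  fixes L :: "real^'n^'n"
  assumes "det L \<noteq> 0"
  shows integrable_gauss_pdf: "integrable lborel (gauss_pdf m (L ** transpose L))"
    and integral_gauss_pdf: "(\<integral>w. gauss_pdf m (L ** transpose L) w \<partial>lborel) = 1"
proof -
  have eq: "gauss_pdf m (L ** transpose L) (m + L *v x) = std_normal_density_cart x / \<bar>det L\<bar>" for x
    using assms by (simp add: gauss_pdf_factor matrix_inv_mult_vec_cancel)
  show "integrable lborel (gauss_pdf m (L ** transpose L))"
    using integrable_lborel_affine_iff[OF assms borel_measurable_gauss_pdf[OF assms], of m m]
      integrable_std_normal_density_cart
    by (auto simp: eq divide_inverse)
  show "(\<integral>w. gauss_pdf m (L ** transpose L) w \<partial>lborel) = 1"
    using integral_lborel_affine[OF assms borel_measurable_gauss_pdf[OF assms], of m m] assms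
    by (simp add: eq integral_std_normal_density_cart)
qed

lemma
  shows integrable_std_normal_density_cart_inner_self:
      "integrable lborel (\<lambda>x::real^'n. std_normal_density_cart x * (x \<bullet> x))"
    and integral_std_normal_density_cart_inner_self:
      "(\<integral>x. std_normal_density_cart (x::real^'n) * (x \<bullet> x) \<partial>lborel) = CARD('n)"
  using integrable_std_normal_density_cart_quadratic[of 0 "mat 1 :: real^'n^'n"]
    integral_std_normal_density_cart_quadratic[of 0 "mat 1 :: real^'n^'n"]
  by (simp_all add: frobenius_sq_mat_1)

lemma ln_gauss_pdf_ratio_affine:
  fixes T L :: "real^'n^'n" and m mu x :: "real^'n"
  assumes dT: "det T \<noteq> 0" and dL: "det L \<noteq> 0"
  defines "y \<equiv> matrix_inv T *v (m - mu)" and "B \<equiv> matrix_inv T ** L"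
  shows "ln (gauss_pdf m (L ** transpose L) (m + L *v x) / gauss_pdf mu (T ** transpose T) (m + L *v x))
    = (y + B *v x) \<bullet> (y + B *v x) / 2 - x \<bullet> x / 2 + (ln \<bar>det T\<bar> - ln \<bar>det L\<bar>)"
proof -
  let ?\<phi> = "std_normal_density_cart :: real^'n \<Rightarrow> real"
  have "gauss_pdf m (L ** transpose L) (m + L *v x) = ?\<phi> x / \<bar>det L\<bar>"
    using dL by (simp add: gauss_pdf_factor matrix_inv_mult_vec_cancel)
  moreover have "gauss_pdf mu (T ** transpose T) (m + L *v x) = ?\<phi> (y + B *v x) / \<bar>det T\<bar>"
    unfolding gauss_pdf_factor[OF dT] y_def B_def
    by (simp add: matrix_vector_right_distrib matrix_vector_mult_diff_distrib matrix_vector_mul_assoc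
        algebra_simps)
  ultimately have "ln (gauss_pdf m (L ** transpose L) (m + L *v x) / gauss_pdf mu (T ** transpose T) (m + L *v x))
      = ln (?\<phi> x) - ln (?\<phi> (y + B *v x)) + (ln \<bar>det T\<bar> - ln \<bar>det L\<bar>)"
    using dL dT std_normal_density_cart_pos[of x] std_normal_density_cart_pos[of "y + B *v x"]
    by (simp add: ln_div ln_mult)
  then show ?thesis
    by (simp add: std_normal_density_cart_eq ln_div)
qed

lemma
  fixes T L :: "real^'n^'n" and m mu :: "real^'n"
  assumes dT: "det T \<noteq> 0" and dL: "det L \<noteq> 0"
  defines "p \<equiv> gauss_pdf m (L ** transpose L)" and "q \<equiv> gauss_pdf mu (T ** transpose T)"
  shows integrable_KL_gauss_pdf: "integrable lborel (\<lambda>w. p w * ln (p w / q w))"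
    and KL_dens_gauss_pdf: "KL_dens p q =
      ((matrix_inv T *v (m - mu)) \<bullet> (matrix_inv T *v (m - mu)) + frobenius_sq (matrix_inv T ** L)
        - real CARD('n)) / 2 + ln \<bar>det T\<bar> - ln \<bar>det L\<bar>"
proof -
  let ?\<phi> = "std_normal_density_cart :: real^'n \<Rightarrow> real"
  define y where "y = matrix_inv T *v (m - mu)"
  define B where "B = matrix_inv T ** L"
  define K where "K = ln \<bar>det T\<bar> - ln \<bar>det L\<bar>"
  define G where
    "G x = (1/2) * (?\<phi> x * ((y + B *v x) \<bullet> (y + B *v x))) - (1/2) * (?\<phi> x * (x \<bullet> x)) + K * ?\<phi> x"
    for x
  have integrand: "p (m + L *v x) * ln (p (m + L *v x) / q (m + L *v x)) = G x / \<bar>det L\<bar>" for x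
    unfolding p_def q_def ln_gauss_pdf_ratio_affine[OF dT dL] unfolding gauss_pdf_factor[OF dL]
    by (simp add: matrix_inv_mult_vec_cancel[OF dL] G_def y_def B_def K_def field_simps)
  have [measurable]: "(\<lambda>w. p w * ln (p w / q w)) \<in> borel_measurable borel"
    unfolding p_def q_def using dL dT by measurable
  note quad = integrable_std_normal_density_cart_quadratic[of y B]
    integral_std_normal_density_cart_quadratic[of y B]
  note sq = integrable_std_normal_density_cart_inner_self integral_std_normal_density_cart_inner_self
  have "integrable lborel G"
    unfolding G_def
    by (intro Bochner_Integration.integrable_add Bochner_Integration.integrable_diff integrable_mult_right
        quad sq integrable_std_normal_density_cart)
  then show "integrable lborel (\<lambda>w. p w * ln (p w / q w))"
    using integrable_lborel_affine_iff[OF dL, of "\<lambda>w. p w * ln (p w / q w)" m]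
    by (simp add: integrand)
  have "KL_dens p q = \<bar>det L\<bar> * (\<integral>x. p (m + L *v x) * ln (p (m + L *v x) / q (m + L *v x)) \<partial>lborel)"
    unfolding KL_dens_def by (rule integral_lborel_affine[OF dL]) measurable
  also have "\<dots> = (\<integral>x. G x \<partial>lborel)"
    using dL by (simp only: integrand) simp
  also have "\<dots> = (1/2) * (y \<bullet> y + frobenius_sq B) - (1/2) * CARD('n) + K * 1"
    unfolding G_def
    by (simp only: Bochner_Integration.integral_add Bochner_Integration.integral_diff
        integral_mult_right_zero Bochner_Integration.integrable_diff integrable_mult_right
        quad sq integrable_std_normal_density_cart integral_std_normal_density_cart)
  finally show "KL_dens p q = (y \<bullet> y + frobenius_sq B - real CARD('n)) / 2 + ln \<bar>det T\<bar> - ln \<bar>det L\<bar>"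
    by (simp add: K_def)
qed

lemma KL_dens_gauss_pdf_nonneg:
  fixes T L :: "real^'n^'n"
  assumes dT: "det T \<noteq> 0" and dL: "det L \<noteq> 0"
  shows "KL_dens (gauss_pdf m (L ** transpose L)) (gauss_pdf mu (T ** transpose T)) \<ge> 0"
proof -
  let ?p = "gauss_pdf m (L ** transpose L)" and ?q = "gauss_pdf mu (T ** transpose T)"
  have pointwise: "?p w - ?q w \<le> ?p w * ln (?p w / ?q w)" for w
  proof -
    have p: "?p w > 0" and q: "?q w > 0"
      using gauss_pdf_pos[OF dL] gauss_pdf_pos[OF dT] by auto
    have "ln (?q w / ?p w) \<le> ?q w / ?p w - 1"
      using p q by (intro ln_le_minus_one) simp
    then have "?p w * (1 - ?q w / ?p w) \<le> ?p w * ln (?p w / ?q w)"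
      using p q by (intro mult_left_mono) (simp_all add: ln_div)
    then show ?thesis
      using p by (simp add: algebra_simps)
  qed
  have "0 = (\<integral>w. ?p w - ?q w \<partial>lborel)"
    using integrable_gauss_pdf[OF dL] integrable_gauss_pdf[OF dT]
      integral_gauss_pdf[OF dL] integral_gauss_pdf[OF dT] by simp
  also have "\<dots> \<le> KL_dens ?p ?q"
    unfolding KL_dens_def
    by (intro integral_mono pointwise integrable_KL_gauss_pdf[OF dT dL] Bochner_Integration.integrable_diff
        integrable_gauss_pdf dL dT)
  finally show ?thesis .
qed

lemma frobenius_sq_ge_log_det:
  fixes C :: "real^'n^'n"
  assumes "det C \<noteq> 0"
  shows "frobenius_sq C - real CARD('n) - 2 * ln \<bar>det C\<bar> \<ge> 0"
proof -
  have I: "matrix_inv (mat 1 :: real^'n^'n) = mat 1" and det_I: "det (mat 1 :: real^'n^'n) \<noteq> 0"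
    by (simp_all add: matrix_inv_unique)
  show ?thesis
    using KL_dens_gauss_pdf_nonneg[OF det_I assms, of 0 0] KL_dens_gauss_pdf[OF det_I assms, of 0 0]
    by (simp add: I)
qed

section \<open>Frobenius norm, orthogonal maps and dilations\<close>

lemma frobenius_sq_eq_trace: "frobenius_sq M = trace (M ** transpose M)"
  by (simp add: frobenius_sq_def trace_def matrix_matrix_mult_def transpose_def power2_eq_square)

lemma frobenius_sq_mult_orthogonal:
  fixes M Q :: "real^'n^'n"
  assumes "orthogonal_matrix Q"
  shows "frobenius_sq (M ** Q) = frobenius_sq M"
proof -
  have "(M ** Q) ** transpose (M ** Q) = M ** (Q ** transpose Q) ** transpose M"
    by (simp add: matrix_transpose_mul matrix_mul_assoc)
  then show ?thesis
    using assms unfolding frobenius_sq_eq_trace orthogonal_matrix_def by simp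
qed

lemma frobenius_sq_orthogonal_mult:
  fixes M Q :: "real^'n^'n"
  assumes "orthogonal_matrix Q"
  shows "frobenius_sq (Q ** M) = frobenius_sq M"
proof -
  have "trace ((Q ** M) ** transpose (Q ** M)) = trace (Q ** (M ** transpose M ** transpose Q))"
    by (simp add: matrix_transpose_mul matrix_mul_assoc)
  also have "\<dots> = trace ((M ** transpose M ** transpose Q) ** Q)"
    by (rule trace_mul_sym)
  also have "\<dots> = trace (M ** transpose M)"
    using assms unfolding orthogonal_matrix_def by (metis matrix_mul_assoc matrix_mul_rid)
  finally show ?thesis
    unfolding frobenius_sq_eq_trace .
qed

definition frame_dilation :: "real^'n^'n \<Rightarrow> 'n \<Rightarrow> real \<Rightarrow> real^'n^'n" where
  "frame_dilation Q k a = Q ** diag_mat (\<chi> i. if i = k then a else 1) ** transpose Q"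

lemma det_diag_mat: "det (diag_mat d) = (\<Prod>i\<in>UNIV. d $ i)"
  unfolding diag_mat_def by (subst det_diagonal) auto

lemma diag_mat_mult_vec: "(diag_mat d *v x) $ i = d $ i * x $ i"
  by (simp add: matrix_vector_mult_def diag_mat_def if_distrib[of "\<lambda>z. z * _"] cong: if_cong)

lemma det_frame_dilation:
  assumes "orthogonal_matrix Q"
  shows "det (frame_dilation Q k a) = a"
proof -
  have "det Q * det (transpose Q) = 1"
    using assms unfolding orthogonal_matrix_def by (metis det_I det_mul)
  then show ?thesis
    unfolding frame_dilation_def det_mul det_diag_mat by (simp add: prod.If_cases algebra_simps)
qed

lemma frame_dilation_mult_vec:
  fixes Q :: "real^'n^'n"
  assumes Q: "orthogonal_matrix Q" and e: "Q *v axis k 1 = e"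
  shows "frame_dilation Q k a *v x = x + ((a - 1) * (e \<bullet> x)) *\<^sub>R e"
proof -
  let ?y = "transpose Q *v x" and ?D = "diag_mat (\<chi> i. if i = k then a else 1) :: real^'n^'n"
  have "?y $ k = ?y \<bullet> axis k 1"
    by (simp add: inner_axis)
  also have "\<dots> = e \<bullet> x"
    by (subst inner_commute) (simp only: inner_transpose_mult_vec e)
  finally have "?D *v ?y = ?y + ((a - 1) * (e \<bullet> x)) *\<^sub>R axis k 1"
    by (simp add: vec_eq_iff diag_mat_mult_vec axis_def algebra_simps)
  moreover have "Q *v ?y = x"
    using Q unfolding orthogonal_matrix_def by (metis matrix_vector_mul_assoc matrix_vector_mul_lid)
  moreover have "frame_dilation Q k a *v x = Q *v (?D *v ?y)"
    unfolding frame_dilation_def by (simp only: matrix_vector_mul_assoc matrix_mul_assoc)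
  ultimately show ?thesis
    by (simp add: matrix_vector_right_distrib matrix_vector_mult_scaleR e)
qed

lemma frobenius_sq_mult_frame_dilation:
  fixes M Q :: "real^'n^'n"
  assumes Q: "orthogonal_matrix Q" and e: "Q *v axis k 1 = e"
  shows "frobenius_sq (M ** frame_dilation Q k a) = frobenius_sq M + (a\<^sup>2 - 1) * ((M *v e) \<bullet> (M *v e))"
proof -
  let ?X = "M ** Q" and ?d = "\<chi> i. if i = k then a else 1"
  have col: "?X $ i $ k = (M *v e) $ i" for i
  proof -
    have "M *v e = ?X *v axis k 1"
      using e by (simp add: matrix_vector_mul_assoc[symmetric])
    then show ?thesis
      by (simp add: matrix_vector_mult_def axis_def if_distrib cong: if_cong)
  qed
  have row: "(\<Sum>j\<in>UNIV. (?X $ i $ j * ?d $ j)\<^sup>2) = (\<Sum>j\<in>UNIV. (?X $ i $ j)\<^sup>2) + (a\<^sup>2 - 1) * (?X $ i $ k)\<^sup>2"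
    for i
  proof -
    have "(\<Sum>j\<in>UNIV. (?X $ i $ j * ?d $ j)\<^sup>2)
        = (\<Sum>j\<in>UNIV. (?X $ i $ j)\<^sup>2 + (if j = k then (a\<^sup>2 - 1) * (?X $ i $ k)\<^sup>2 else 0))"
      by (intro sum.cong refl) (auto simp: power_mult_distrib algebra_simps)
    then show ?thesis
      by (simp add: sum.distrib)
  qed
  have "frobenius_sq (M ** frame_dilation Q k a) = frobenius_sq (?X ** diag_mat ?d ** transpose Q)"
    unfolding frame_dilation_def by (simp add: matrix_mul_assoc)
  also have "\<dots> = frobenius_sq (?X ** diag_mat ?d)"
    using Q by (simp add: frobenius_sq_mult_orthogonal)
  also have "\<dots> = (\<Sum>i\<in>UNIV. \<Sum>j\<in>UNIV. (?X $ i $ j * ?d $ j)\<^sup>2)"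
    unfolding frobenius_sq_def
    by (simp add: matrix_matrix_mult_def diag_mat_def if_distrib[of "\<lambda>x. _ * x"] cong: if_cong)
  also have "\<dots> = frobenius_sq ?X + (a\<^sup>2 - 1) * (\<Sum>i\<in>UNIV. (?X $ i $ k)\<^sup>2)"
    unfolding row by (simp add: frobenius_sq_def sum.distrib sum_distrib_left)
  also have "\<dots> = frobenius_sq M + (a\<^sup>2 - 1) * ((M *v e) \<bullet> (M *v e))"
    using frobenius_sq_mult_orthogonal[OF Q, of M] by (simp add: col inner_vec_def power2_eq_square)
  finally show ?thesis .
qed

lemma frobenius_sq_log_det_lower_bound:
  fixes B :: "real^'n^'n" and e :: "real^'n"
  assumes dB: "det B \<noteq> 0" and e: "norm e = 1"
  shows "norm (B *v e) > 0"
    and "frobenius_sq B - 2 * ln \<bar>det B\<bar>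
      \<ge> real CARD('n) - 1 + (norm (B *v e))\<^sup>2 - 2 * ln (norm (B *v e))"
proof -
  define \<rho> where "\<rho> = norm (B *v e)"
  have "B *v e \<noteq> 0"
    using matrix_inv_mult_vec_cancel[OF dB, of e] e by force
  then show "norm (B *v e) > 0"
    by simp
  then have \<rho>: "\<rho> > 0"
    by (simp add: \<rho>_def)
  obtain k :: 'n where True by simp
  obtain Q where Q: "orthogonal_matrix Q" "Q *v axis k 1 = e"
    using orthogonal_matrix_exists_basis[OF e] by metis
  define C where "C = B ** frame_dilation Q k (1 / \<rho>)"
  have det_C: "det C = det B / \<rho>"
    unfolding C_def det_mul det_frame_dilation[OF Q(1)] by simp
  have "(B *v e) \<bullet> (B *v e) = \<rho>\<^sup>2"
    by (simp add: \<rho>_def dot_square_norm)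
  then have "frobenius_sq C = frobenius_sq B + 1 - \<rho>\<^sup>2"
    unfolding C_def frobenius_sq_mult_frame_dilation[OF Q] using \<rho> by (simp add: field_simps)
  moreover have "frobenius_sq C - real CARD('n) - 2 * ln \<bar>det C\<bar> \<ge> 0"
    using dB \<rho> det_C by (intro frobenius_sq_ge_log_det) simp
  moreover have "ln \<bar>det C\<bar> = ln \<bar>det B\<bar> - ln \<rho>"
    unfolding det_C using dB \<rho> by (simp add: ln_div)
  ultimately show "frobenius_sq B - 2 * ln \<bar>det B\<bar>
      \<ge> real CARD('n) - 1 + (norm (B *v e))\<^sup>2 - 2 * ln (norm (B *v e))"
    unfolding \<rho>_def[symmetric] by simp
qed

lemma quadratic_minus_log_minimal:
  fixes k a r \<rho> :: real
  assumes k: "k > 0" and r: "r > 0" and root: "k * r\<^sup>2 - a * r - 1 = 0" and \<rho>: "\<rho> > 0"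
  shows "k * \<rho>\<^sup>2 - 2 * a * \<rho> - 2 * ln \<rho> \<ge> k * r\<^sup>2 - 2 * a * r - 2 * ln r"
proof -
  have "ln \<rho> - ln r \<le> \<rho> / r - 1"
    using ln_le_minus_one[of "\<rho> / r"] \<rho> r by (simp add: ln_div)
  also have "\<rho> / r - 1 = (\<rho> - r) * (k * r - a)"
  proof -
    have "r * (k * r - a) = 1"
      using root by (simp add: algebra_simps power2_eq_square)
    then show ?thesis
      using r by (simp add: field_simps)
  qed
  finally have "ln \<rho> - ln r \<le> (\<rho> - r) * (k * r - a)" .
  moreover have "k * (\<rho> - r)\<^sup>2 \<ge> 0"
    using k by simp
  ultimately show ?thesis
    by (simp add: algebra_simps power2_eq_square)
qed

section \<open>Matrices acting on a plane\<close>

lemma matrix_add_rdistrib: "(A + B) ** C = A ** C + B ** (C :: 'a::semiring_1^'n^'m)"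
  by (vector matrix_matrix_mult_def sum.distrib[symmetric] distrib_right)

lemma matrix_diff_ldistrib: "A ** (B - C) = A ** B - A ** (C :: 'a::ring_1^'n^'m)"
  by (vector matrix_matrix_mult_def sum_subtractf[symmetric] right_diff_distrib)

lemma matrix_diff_rdistrib: "(A - B) ** C = A ** C - B ** (C :: 'a::ring_1^'n^'m)"
  by (vector matrix_matrix_mult_def sum_subtractf[symmetric] left_diff_distrib)

definition plane_frame :: "real^'n \<Rightarrow> real^'n \<Rightarrow> real^2^'n" where
  "plane_frame e f = (\<chi> i k. if k = 1 then e $ i else f $ i)"

definition plane_lift :: "real^'n \<Rightarrow> real^'n \<Rightarrow> real^2^2 \<Rightarrow> real^'n^'n" where
  "plane_lift e f M = mat 1 + plane_frame e f ** (M - mat 1) ** transpose (plane_frame e f)"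

lemma transpose_plane_frame_mult_vec:
  "transpose (plane_frame e f) *v x = vector [e \<bullet> x, f \<bullet> x]"
  by (simp add: vec_eq_iff forall_2 matrix_vector_mult_def transpose_def plane_frame_def inner_vec_def
      mult.commute)

lemma plane_frame_mult_vec: "plane_frame e f *v y = (y $ 1) *\<^sub>R e + (y $ 2) *\<^sub>R f"
  by (simp add: vec_eq_iff matrix_vector_mult_def sum_2 plane_frame_def mult.commute)

lemma plane_lift_mult_vec:
  "plane_lift e f M *v x = x + ((M $ 1 $ 1 - 1) * (e \<bullet> x) + M $ 1 $ 2 * (f \<bullet> x)) *\<^sub>R e
      + (M $ 2 $ 1 * (e \<bullet> x) + (M $ 2 $ 2 - 1) * (f \<bullet> x)) *\<^sub>R f"
proof -
  have "plane_lift e f M *v x = x + plane_frame e f *v ((M - mat 1) *v (transpose (plane_frame e f) *v x))"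
    unfolding plane_lift_def by (simp only: matrix_vector_mult_add_rdistrib matrix_vector_mul_assoc
        matrix_mul_assoc matrix_vector_mul_lid)
  also have "(M - mat 1) *v (transpose (plane_frame e f) *v x)
      = vector [(M $ 1 $ 1 - 1) * (e \<bullet> x) + M $ 1 $ 2 * (f \<bullet> x), M $ 2 $ 1 * (e \<bullet> x) + (M $ 2 $ 2 - 1) * (f \<bullet> x)]"
    unfolding transpose_plane_frame_mult_vec
    by (simp add: vec_eq_iff forall_2 matrix_vector_mult_def sum_2 mat_def)
  finally show ?thesis
    by (simp add: plane_frame_mult_vec add.assoc)
qed

lemma transpose_plane_frame_mult_plane_frame:
  assumes "norm e = 1" "norm f = 1" "e \<bullet> f = 0"
  shows "transpose (plane_frame e f) ** plane_frame e f = mat 1"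
proof -
  have "e \<bullet> e = 1" "f \<bullet> f = 1" "e \<bullet> f = 0" "f \<bullet> e = 0"
    using assms by (simp_all add: norm_eq_1 inner_commute)
  then show ?thesis
    by (simp add: vec_eq_iff forall_2 matrix_matrix_mult_def transpose_def plane_frame_def mat_def
        inner_vec_def)
qed

lemma plane_lift_mult:
  assumes "norm e = 1" "norm f = 1" "e \<bullet> f = 0"
  shows "plane_lift e f M ** plane_lift e f N = plane_lift e f (M ** N)"
proof -
  let ?W = "plane_frame e f"
  have WW: "Z ** transpose ?W ** ?W = Z" for Z :: "real^2^'n"
    using transpose_plane_frame_mult_plane_frame[OF assms] by (metis matrix_mul_assoc matrix_mul_rid)
  have "?W ** (M - mat 1) ** transpose ?W ** (?W ** (N - mat 1) ** transpose ?W)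
      = ?W ** ((M - mat 1) ** (N - mat 1)) ** transpose ?W"
    by (simp only: matrix_mul_assoc WW)
  moreover have "M ** N - mat 1 = (M - mat 1) + (N - mat 1) + (M - mat 1) ** (N - mat 1)"
    by (simp add: matrix_diff_ldistrib matrix_diff_rdistrib)
  then have "?W ** (M ** N - mat 1) ** transpose ?W = ?W ** (M - mat 1) ** transpose ?W
      + ?W ** (N - mat 1) ** transpose ?W + ?W ** ((M - mat 1) ** (N - mat 1)) ** transpose ?W"
    by (simp only: matrix_add_ldistrib matrix_add_rdistrib)
  ultimately show ?thesis
    unfolding plane_lift_def by (simp add: matrix_add_ldistrib matrix_add_rdistrib add.assoc)
qed

lemma plane_lift_mat_1: "plane_lift e f (mat 1) = mat 1"
  by (simp add: plane_lift_def)

lemma transpose_plane_lift: "transpose (plane_lift e f M) = plane_lift e f (transpose M)"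
proof -
  have add: "transpose (A + B) = transpose A + transpose B" for A B :: "real^'n^'n"
    by (simp add: transpose_def vec_eq_iff)
  have diff: "transpose (M - mat 1) = transpose M - mat 1"
    by (simp add: transpose_def mat_def vec_eq_iff)
  show ?thesis
    unfolding plane_lift_def add by (simp add: matrix_transpose_mul matrix_mul_assoc diff)
qed

lemma orthogonal_matrix_plane_lift:
  assumes "norm e = 1" "norm f = 1" "e \<bullet> f = 0" and "orthogonal_matrix M"
  shows "orthogonal_matrix (plane_lift e f M)"
  using assms plane_lift_mult[OF assms(1-3)]
  by (simp add: orthogonal_matrix_def transpose_plane_lift plane_lift_mat_1)

lemma plane_lift_diagonal_eq_frame_dilation:
  fixes Q :: "real^'n^'n"
  assumes "orthogonal_matrix Q" "Q *v axis k 1 = e" "e \<bullet> f = 0"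
  shows "plane_lift e f (vector [vector [c, 0], vector [0, 1]]) = frame_dilation Q k c"
  unfolding matrix_eq
  by (simp add: plane_lift_mult_vec frame_dilation_mult_vec[OF assms(1,2)])

lemma orthogonal_matrix_plane_rotation:
  fixes a b s d :: real
  assumes s: "s > 0" "s\<^sup>2 = a\<^sup>2 + b\<^sup>2" and d: "d\<^sup>2 = 1"
  shows "orthogonal_matrix ((1 / s) *\<^sub>R (vector [vector [a, - d * b], vector [b, d * a]] :: real^2^2))"
proof -
  let ?X = "vector [vector [a, - d * b], vector [b, d * a]] :: real^2^2"
  have "d = 1 \<or> d = - 1"
    using d power2_eq_1_iff[of d] by simp
  then have "?X ** transpose ?X = (a\<^sup>2 + b\<^sup>2) *\<^sub>R mat 1"
    by (auto simp: vec_eq_iff forall_2 matrix_matrix_mult_def sum_2 transpose_def mat_def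
        power2_eq_square)
  moreover have "\<not> (a = 0 \<and> b = 0)"
    using s by auto
  ultimately have "((1 / s) *\<^sub>R ?X) ** transpose ((1 / s) *\<^sub>R ?X) = mat 1"
    using s by (auto simp add: transpose_scalar matrix_scalar_ac scalar_matrix_assoc[symmetric]
        power2_eq_square)
  then show ?thesis
    by (simp add: orthogonal_matrix_def matrix_left_right_inverse)
qed

lemma plane_lift_optimum:
  fixes e f :: "real^'n" and c s d vpar vperp :: real
  assumes e: "norm e = 1" and f: "norm f = 1" and ef: "e \<bullet> f = 0"
    and s: "s > 0" "s\<^sup>2 = vpar\<^sup>2 + vperp\<^sup>2" and d: "d\<^sup>2 = 1"
  defines "B \<equiv> plane_lift e f ((1 / s) *\<^sub>R
      (vector [vector [c * vpar, - d * vperp], vector [c * vperp, d * vpar]] :: real^2^2))"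
  shows "B *v e = (c / s) *\<^sub>R (vpar *\<^sub>R e + vperp *\<^sub>R f)"
    and "frobenius_sq B = real CARD('n) - 1 + c\<^sup>2"
    and "\<bar>det B\<bar> = \<bar>c\<bar>"
proof -
  let ?R = "(1 / s) *\<^sub>R (vector [vector [vpar, - d * vperp], vector [vperp, d * vpar]] :: real^2^2)"
  have "e \<bullet> e = 1"
    using e by (simp add: norm_eq_1)
  then show "B *v e = (c / s) *\<^sub>R (vpar *\<^sub>R e + vperp *\<^sub>R f)"
    unfolding B_def plane_lift_mult_vec using ef
    by (simp add: inner_commute[of f e] algebra_simps scaleR_add_right)
  have "orthogonal_matrix ?R"
    using s d by (rule orthogonal_matrix_plane_rotation)
  then have R: "orthogonal_matrix (plane_lift e f ?R)"
    by (rule orthogonal_matrix_plane_lift[OF e f ef])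
  obtain k :: 'n where True by simp
  obtain Q where Q: "orthogonal_matrix Q" "Q *v axis k 1 = e"
    using orthogonal_matrix_exists_basis[OF e] by metis
  have "?R ** vector [vector [c, 0], vector [0, 1]]
      = (1 / s) *\<^sub>R (vector [vector [c * vpar, - d * vperp], vector [c * vperp, d * vpar]] :: real^2^2)"
    by (simp add: vec_eq_iff forall_2 matrix_matrix_mult_def sum_2)
  then have B: "B = plane_lift e f ?R ** frame_dilation Q k c"
    unfolding B_def using plane_lift_mult[OF e f ef, of ?R] plane_lift_diagonal_eq_frame_dilation[OF Q ef]
    by metis
  have "frobenius_sq B = frobenius_sq (mat 1 ** frame_dilation Q k c)"
    unfolding B using frobenius_sq_orthogonal_mult[OF R] by simp
  also have "\<dots> = real CARD('n) - 1 + c\<^sup>2"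
    unfolding frobenius_sq_mult_frame_dilation[OF Q] frobenius_sq_mat_1 using \<open>e \<bullet> e = 1\<close> by simp
  finally show "frobenius_sq B = real CARD('n) - 1 + c\<^sup>2" .
  show "\<bar>det B\<bar> = \<bar>c\<bar>"
    using det_orthogonal_matrix[OF R] unfolding B det_mul det_frame_dilation[OF Q(1)] by auto
qed

section \<open>The whitened minimisation problem\<close>

lemma optimal_scale:
  fixes u V :: real
  assumes V: "V > 0"
  defines "c \<equiv> (u * sqrt V + (if u \<ge> 0 then 1 else - 1) * sqrt (4 + u\<^sup>2 * (4 + V))) / (2 * (1 + u\<^sup>2))"
  shows "\<bar>c\<bar> > 0"
    and "(1 + u\<^sup>2) * \<bar>c\<bar>\<^sup>2 - (\<bar>u\<bar> * sqrt V) * \<bar>c\<bar> - 1 = 0"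
    and "u * c = \<bar>u\<bar> * \<bar>c\<bar>"
proof -
  define q where "q = sqrt (4 + u\<^sup>2 * (4 + V))"
  define r where "r = (\<bar>u\<bar> * sqrt V + q) / (2 * (1 + u\<^sup>2))"
  have q: "q > 0" "q\<^sup>2 = 4 + u\<^sup>2 * (4 + V)"
    unfolding q_def using V by (simp_all add: add_pos_nonneg)
  have k: "1 + u\<^sup>2 > 0"
    by (simp add: add_pos_nonneg)
  have c: "c = (if u \<ge> 0 then 1 else - 1) * r"
    unfolding c_def r_def q_def[symmetric] by (auto simp: field_simps)
  have r: "r > 0"
    unfolding r_def using q k V by (intro divide_pos_pos add_nonneg_pos) simp_all
  then have abs_c: "\<bar>c\<bar> = r"
    unfolding c by auto
  show "\<bar>c\<bar> > 0" "u * c = \<bar>u\<bar> * \<bar>c\<bar>"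
    using r unfolding abs_c unfolding c by auto
  have "(1 + u\<^sup>2) * r\<^sup>2 - (\<bar>u\<bar> * sqrt V) * r - 1
      = (q\<^sup>2 - (\<bar>u\<bar> * sqrt V)\<^sup>2 - 4 * (1 + u\<^sup>2)) / (4 * (1 + u\<^sup>2))"
  proof -
    have "k * ((a + b) / (2 * k))\<^sup>2 - a * ((a + b) / (2 * k)) - 1 = (b\<^sup>2 - a\<^sup>2 - 4 * k) / (4 * k)"
      if "k > 0" for k a b :: real
      using that by (simp add: field_simps power2_eq_square)
    then show ?thesis
      unfolding r_def using k by blast
  qed
  also have "\<dots> = 0"
    using V by (simp add: q(2) power_mult_distrib algebra_simps)
  finally show "(1 + u\<^sup>2) * \<bar>c\<bar>\<^sup>2 - (\<bar>u\<bar> * sqrt V) * \<bar>c\<bar> - 1 = 0"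
    unfolding abs_c .
qed

definition whitened_KL_objective :: "real^'n^'n \<Rightarrow> real \<Rightarrow> real^'n \<Rightarrow> real^'n \<Rightarrow> real" where
  "whitened_KL_objective B u e z =
     frobenius_sq B + (z - u *\<^sub>R (B *v e)) \<bullet> (z - u *\<^sub>R (B *v e)) - 2 * ln \<bar>det B\<bar>"

lemma whitened_KL_objective_lower_bound:
  fixes B :: "real^'n^'n" and e z :: "real^'n" and u r :: real
  assumes dB: "det B \<noteq> 0" and e: "norm e = 1"
    and r: "r > 0" "(1 + u\<^sup>2) * r\<^sup>2 - (\<bar>u\<bar> * norm z) * r - 1 = 0"
  shows "whitened_KL_objective B u e z
    \<ge> real CARD('n) - 1 + (norm z)\<^sup>2 + (1 + u\<^sup>2) * r\<^sup>2 - 2 * (\<bar>u\<bar> * norm z) * r - 2 * ln r"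
proof -
  define \<rho> where "\<rho> = norm (B *v e)"
  have \<rho>: "\<rho> > 0"
    and "frobenius_sq B - 2 * ln \<bar>det B\<bar> \<ge> real CARD('n) - 1 + \<rho>\<^sup>2 - 2 * ln \<rho>"
    using frobenius_sq_log_det_lower_bound[OF dB e] unfolding \<rho>_def by auto
  moreover have "u * (z \<bullet> (B *v e)) \<le> \<bar>u\<bar> * (norm z * \<rho>)"
  proof -
    have "u * (z \<bullet> (B *v e)) \<le> \<bar>u\<bar> * \<bar>z \<bullet> (B *v e)\<bar>"
      by (metis abs_ge_self abs_mult)
    also have "\<dots> \<le> \<bar>u\<bar> * (norm z * \<rho>)"
      unfolding \<rho>_def by (intro mult_left_mono Cauchy_Schwarz_ineq2) simp
    finally show ?thesis .
  qed
  moreover have "(z - u *\<^sub>R (B *v e)) \<bullet> (z - u *\<^sub>R (B *v e))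
      = (norm z)\<^sup>2 - 2 * u * (z \<bullet> (B *v e)) + u\<^sup>2 * \<rho>\<^sup>2"
    using dot_square_norm[of "B *v e"] dot_square_norm[of z]
    by (simp add: \<rho>_def inner_diff_left inner_diff_right inner_commute[of "B *v e" z]
        algebra_simps power2_eq_square)
  moreover have "(1 + u\<^sup>2) * \<rho>\<^sup>2 - 2 * (\<bar>u\<bar> * norm z) * \<rho> - 2 * ln \<rho>
      \<ge> (1 + u\<^sup>2) * r\<^sup>2 - 2 * (\<bar>u\<bar> * norm z) * r - 2 * ln r"
    using r \<rho> by (intro quadratic_minus_log_minimal) (simp_all add: add_pos_nonneg)
  ultimately show ?thesis
    unfolding whitened_KL_objective_def by (simp add: algebra_simps)
qed

lemma whitened_KL_objective_minimal:
  fixes e f :: "real^'n" and u vpar vperp :: real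
  assumes e: "norm e = 1" and f: "norm f = 1" and ef: "e \<bullet> f = 0"
    and V_def: "V = vpar\<^sup>2 + vperp\<^sup>2" and V: "V > 0"
    and c_def: "c = (u * sqrt V + (if u \<ge> 0 then 1 else - 1) * sqrt (4 + u\<^sup>2 * (4 + V))) / (2 * (1 + u\<^sup>2))"
    and B\<^sub>0_def: "B\<^sub>0 = plane_lift e f ((1 / sqrt V) *\<^sub>R
      (vector [vector [c * vpar, - 1 * vperp], vector [c * vperp, 1 * vpar]] :: real^2^2))"
    and z_def: "z = vpar *\<^sub>R e + vperp *\<^sub>R f"
  shows "det B\<^sub>0 \<noteq> 0"
    and "det B \<noteq> 0 \<Longrightarrow> whitened_KL_objective B\<^sub>0 u e z \<le> whitened_KL_objective B u e z"
proof -
  have V: "V > 0" "sqrt V > 0" "(sqrt V)\<^sup>2 = V"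
    using V by simp_all
  have zz: "z \<bullet> z = V"
    using e f ef
    by (simp add: z_def V_def inner_add_left inner_add_right inner_commute[of f e] norm_eq_1
        power2_eq_square)
  then have norm_z: "norm z = sqrt V"
    by (simp add: norm_eq_sqrt_inner)
  define r where "r = \<bar>c\<bar>"
  have r: "r > 0" "(1 + u\<^sup>2) * r\<^sup>2 - (\<bar>u\<bar> * sqrt V) * r - 1 = 0" "u * c = \<bar>u\<bar> * r"
    using optimal_scale[OF V(1), of u] unfolding r_def c_def by auto
  have B\<^sub>0: "B\<^sub>0 *v e = (c / sqrt V) *\<^sub>R z" "frobenius_sq B\<^sub>0 = real CARD('n) - 1 + r\<^sup>2"
    "\<bar>det B\<^sub>0\<bar> = r"
    using plane_lift_optimum[OF e f ef V(2), of vpar vperp 1 c] V(3)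
    by (simp_all add: B\<^sub>0_def z_def r_def V_def)
  then show "det B\<^sub>0 \<noteq> 0"
    using r by auto
  have "(z - u *\<^sub>R (B\<^sub>0 *v e)) \<bullet> (z - u *\<^sub>R (B\<^sub>0 *v e)) = (1 - u * c / sqrt V)\<^sup>2 * V"
    unfolding B\<^sub>0 by (simp add: algebra_simps zz power2_eq_square)
  also have "\<dots> = V - 2 * (\<bar>u\<bar> * sqrt V) * r + u\<^sup>2 * r\<^sup>2"
    using V r(3) by (simp add: power2_eq_square field_simps)
  finally have "whitened_KL_objective B\<^sub>0 u e z
      = real CARD('n) - 1 + V + (1 + u\<^sup>2) * r\<^sup>2 - 2 * (\<bar>u\<bar> * sqrt V) * r - 2 * ln r"
    unfolding whitened_KL_objective_def B\<^sub>0 by (simp add: algebra_simps)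
  moreover assume "det B \<noteq> 0"
  ultimately show "whitened_KL_objective B\<^sub>0 u e z \<le> whitened_KL_objective B u e z"
    using whitened_KL_objective_lower_bound[OF _ e r(1), where B=B and z=z and u=u] r(2) norm_z V(3)
    by simp
qed

lemma KL_affine_eq_whitened_KL_objective:
  fixes T A :: "real^'n^'n"
  assumes dT: "det T \<noteq> 0" and dA: "det A \<noteq> 0" and wb: "w' = A *v w + b"
    and u: "matrix_inv T *v (w - mu) = u *\<^sub>R e" and z: "matrix_inv T *v (w' - mu) = z"
  shows "KL_affine mu (T ** transpose T) A b
    = (whitened_KL_objective (matrix_inv T ** A ** T) u e z - real CARD('n)) / 2"
proof -
  let ?Ti = "matrix_inv T" and ?B = "matrix_inv T ** A ** T"
  have dAT: "det (A ** T) \<noteq> 0"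
    using dA dT by (simp add: det_mul)
  have "det ?Ti * det T = 1"
    using matrix_inv_left[of T] dT by (metis det_I det_mul invertible_det_nz)
  then have det_B: "det ?B = det A"
    by (simp add: det_mul algebra_simps)
  have "?Ti *v (A *v mu + b - mu) = ?Ti *v (w' - mu) - ?Ti *v (A *v (T *v (?Ti *v (w - mu))))"
    using wb by (simp add: mult_vec_matrix_inv_cancel[OF dT] matrix_vector_mult_diff_distrib algebra_simps)
  also have "\<dots> = z - u *\<^sub>R (?B *v e)"
    by (simp add: z u matrix_vector_mul_assoc matrix_mul_assoc matrix_vector_mult_scaleR)
  finally have y: "?Ti *v (A *v mu + b - mu) = z - u *\<^sub>R (?B *v e)" .
  have "A ** (T ** transpose T) ** transpose A = (A ** T) ** transpose (A ** T)"
    by (simp add: matrix_transpose_mul matrix_mul_assoc)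
  then have "KL_affine mu (T ** transpose T) A b
      = KL_dens (gauss_pdf (A *v mu + b) ((A ** T) ** transpose (A ** T))) (gauss_pdf mu (T ** transpose T))"
    by (simp add: KL_affine_def)
  also have "\<dots> = ((z - u *\<^sub>R (?B *v e)) \<bullet> (z - u *\<^sub>R (?B *v e)) + frobenius_sq ?B - real CARD('n)) / 2
      + ln \<bar>det T\<bar> - ln \<bar>det (A ** T)\<bar>"
    unfolding KL_dens_gauss_pdf[OF dT dAT] y by (simp add: matrix_mul_assoc)
  also have "ln \<bar>det (A ** T)\<bar> = ln \<bar>det ?B\<bar> + ln \<bar>det T\<bar>"
    unfolding det_B using dA dT by (simp add: det_mul abs_mult ln_mult)
  finally show ?thesis
    by (simp add: whitened_KL_objective_def field_simps)
qed

lemma whitening_factor: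
  fixes U :: "real^'n^'n" and dd :: "real^'n"
  assumes U: "orthogonal_matrix U" and dd: "\<forall>i. dd $ i > 0"
  defines "T \<equiv> U ** diag_mat (\<chi> i. sqrt (dd $ i))"
  shows "U ** diag_mat dd ** transpose U = T ** transpose T"
    and "matrix_inv T = diag_mat (\<chi> i. 1 / sqrt (dd $ i)) ** transpose U"
    and "det T \<noteq> 0"
proof -
  let ?D = "diag_mat (\<chi> i. sqrt (dd $ i))" and ?Di = "diag_mat (\<chi> i. 1 / sqrt (dd $ i))"
  have diag_mult: "diag_mat a ** diag_mat b = diag_mat (\<chi> i. a $ i * b $ i)" for a b :: "real^'n"
    by (simp add: diag_mat_def matrix_matrix_mult_def vec_eq_iff if_distrib[of "\<lambda>x. x * _"]
        cong: if_cong)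
  have "diag_mat (\<chi> i. 1) = (mat 1 :: real^'n^'n)"
    by (simp add: diag_mat_def mat_def vec_eq_iff)
  then have DDi: "?D ** ?Di = mat 1" "?Di ** ?D = mat 1"
    using dd by (simp_all add: diag_mult less_imp_neq[symmetric])
  have UU: "U ** transpose U = mat 1" "transpose U ** U = mat 1"
    using U unfolding orthogonal_matrix_def by auto
  have "T ** (?Di ** transpose U) = U ** (?D ** ?Di) ** transpose U"
    "(?Di ** transpose U) ** T = ?Di ** (transpose U ** U) ** ?D"
    unfolding T_def by (simp_all add: matrix_mul_assoc)
  then have "T ** (?Di ** transpose U) = mat 1" "(?Di ** transpose U) ** T = mat 1"
    using DDi UU by simp_all
  then show inv: "matrix_inv T = ?Di ** transpose U"
    by (rule matrix_inv_unique)
  show "det T \<noteq> 0"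
    using \<open>T ** (?Di ** transpose U) = mat 1\<close> by (metis det_I det_mul mult_zero_left zero_neq_one)
  have "transpose ?D = ?D"
    by (simp add: diag_mat_def transpose_def vec_eq_iff)
  moreover have "?D ** ?D = diag_mat dd"
    using dd by (simp add: diag_mult vec_eq_iff less_imp_le)
  ultimately show "U ** diag_mat dd ** transpose U = T ** transpose T"
    unfolding T_def by (metis matrix_transpose_mul matrix_mul_assoc)
qed

lemma KL_affine_minimal_of_whitened:
  fixes T B\<^sub>0 :: "real^'n^'n"
  assumes dT: "det T \<noteq> 0"
    and u: "matrix_inv T *v (w - mu) = u *\<^sub>R e" and z: "matrix_inv T *v (w' - mu) = z"
    and dB\<^sub>0: "det B\<^sub>0 \<noteq> 0"
    and minimal: "\<And>B. det B \<noteq> 0 \<Longrightarrow> whitened_KL_objective B\<^sub>0 u e z \<le> whitened_KL_objective B u e z"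
  defines "A\<^sub>0 \<equiv> T ** B\<^sub>0 ** matrix_inv T"
  shows "invertible A\<^sub>0"
    and "invertible A \<Longrightarrow> w' = A *v w + b \<Longrightarrow>
      KL_affine mu (T ** transpose T) A\<^sub>0 (w' - A\<^sub>0 *v w) \<le> KL_affine mu (T ** transpose T) A b"
proof -
  have inv: "matrix_inv T ** T = mat 1" "T ** matrix_inv T = mat 1"
    using dT by (simp_all add: matrix_inv_left matrix_inv_right invertible_det_nz)
  then have "det (matrix_inv T) * det T = 1"
    by (metis det_I det_mul)
  moreover have "det A\<^sub>0 = det B\<^sub>0 * (det (matrix_inv T) * det T)"
    by (simp add: A\<^sub>0_def det_mul mult_ac)
  ultimately have det_A\<^sub>0: "det A\<^sub>0 = det B\<^sub>0" and "det (matrix_inv T) \<noteq> 0"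
    by auto
  then show "invertible A\<^sub>0"
    using dB\<^sub>0 by (simp add: invertible_det_nz)
  have B\<^sub>0: "matrix_inv T ** A\<^sub>0 ** T = B\<^sub>0"
    using inv unfolding A\<^sub>0_def by (metis matrix_mul_assoc matrix_mul_lid matrix_mul_rid)
  have "KL_affine mu (T ** transpose T) A\<^sub>0 (w' - A\<^sub>0 *v w)
      = (whitened_KL_objective B\<^sub>0 u e z - real CARD('n)) / 2"
    using KL_affine_eq_whitened_KL_objective[OF dT _ _ u z, of A\<^sub>0] dB\<^sub>0 by (simp add: det_A\<^sub>0 B\<^sub>0)
  moreover assume "invertible A" "w' = A *v w + b"
  then have "det (matrix_inv T ** A ** T) \<noteq> 0"
    and "KL_affine mu (T ** transpose T) A b
      = (whitened_KL_objective (matrix_inv T ** A ** T) u e z - real CARD('n)) / 2"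
    using KL_affine_eq_whitened_KL_objective[OF dT _ _ u z] \<open>det (matrix_inv T) \<noteq> 0\<close> dT
    by (simp_all add: invertible_det_nz det_mul)
  ultimately show "KL_affine mu (T ** transpose T) A\<^sub>0 (w' - A\<^sub>0 *v w) \<le> KL_affine mu (T ** transpose T) A b"
    using minimal[of "matrix_inv T ** A ** T"] by simp
qed

theorem theorem1:
  fixes mu w w' muh nuh :: "real^'n"
    and S U :: "real^'n^'n"
    and dd :: "real^'n"
    and u vpar vperp :: real
  assumes "CARD('n) \<ge> 2"
    and "sym_posdef S"
    and "orthogonal_matrix U"
    and "\<forall>i. dd $ i > 0"
    and "S = U ** diag_mat dd ** transpose U"
    and "w' \<noteq> mu"
    and "norm muh = 1" and "norm nuh = 1" and "muh \<bullet> nuh = 0"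
    and "u *\<^sub>R muh = diag_mat (\<chi> i. 1 / sqrt (dd $ i)) ** transpose U *v (w - mu)"
    and "vpar *\<^sub>R muh + vperp *\<^sub>R nuh
           = diag_mat (\<chi> i. 1 / sqrt (dd $ i)) ** transpose U *v (w' - mu)"
  shows "\<exists>delta1 delta2 :: real. delta1 \<in> {-1, 1} \<and> delta2 \<in> {-1, 1} \<and>
    (let V = vpar\<^sup>2 + vperp\<^sup>2;
         c = (u * sqrt V + delta1 * sqrt (4 + u\<^sup>2 * (4 + V))) / (2 * (1 + u\<^sup>2));
         A2 = (1 / sqrt V) *\<^sub>R (vector [vector [c * vpar, - delta2 * vperp],
                                          vector [c * vperp, delta2 * vpar]] :: real^2^2);
         W = (\<chi> i k. if k = 1 then muh $ i else nuh $ i) :: real^2^'n;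
         Astar = mat 1 + U ** diag_mat (\<chi> i. sqrt (dd $ i))
                   ** (W ** (A2 - mat 1) ** transpose W)
                   ** diag_mat (\<chi> i. 1 / sqrt (dd $ i)) ** transpose U;
         bstar = w' - Astar *v w
     in invertible Astar \<and> w' = Astar *v w + bstar
        \<and> (\<forall>A b. invertible A \<and> w' = A *v w + b \<longrightarrow>
              KL_affine mu S Astar bstar \<le> KL_affine mu S A b)
        \<and> Astar *v mu + bstar = Astar *v (mu - w) + w')"
proof -
  define T where "T = U ** diag_mat (\<chi> i. sqrt (dd $ i))"
  note T = whitening_factor[OF assms(3,4), folded T_def]
  define z where "z = vpar *\<^sub>R muh + vperp *\<^sub>R nuh"
  have u: "matrix_inv T *v (w - mu) = u *\<^sub>R muh" and z: "matrix_inv T *v (w' - mu) = z"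
    using assms(10,11) by (simp_all add: T(2) z_def)
  have "z \<noteq> 0"
    using assms(6) mult_vec_matrix_inv_cancel[OF T(3), of "w' - mu"] by (auto simp: z)
  define V where "V = vpar\<^sup>2 + vperp\<^sup>2"
  have "V > 0"
    using \<open>z \<noteq> 0\<close> by (auto simp: V_def z_def sum_power2_gt_zero_iff)
  define d1 where "d1 = (if u \<ge> 0 then 1 else - 1 :: real)"
  define c where "c = (u * sqrt V + d1 * sqrt (4 + u\<^sup>2 * (4 + V))) / (2 * (1 + u\<^sup>2))"
  define A2 where "A2 = (1 / sqrt V) *\<^sub>R (vector [vector [c * vpar, - 1 * vperp],
      vector [c * vperp, 1 * vpar]] :: real^2^2)"
  define B\<^sub>0 where "B\<^sub>0 = plane_lift muh nuh A2"
  note B\<^sub>0_minimal = whitened_KL_objective_minimal[OF assms(7-9) V_def \<open>V > 0\<close>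
      c_def[unfolded d1_def] B\<^sub>0_def[unfolded A2_def] z_def]
  have "T ** B\<^sub>0 ** matrix_inv T = mat 1 + U ** diag_mat (\<chi> i. sqrt (dd $ i))
      ** (plane_frame muh nuh ** (A2 - mat 1) ** transpose (plane_frame muh nuh))
      ** diag_mat (\<chi> i. 1 / sqrt (dd $ i)) ** transpose U"
    using matrix_inv_right[of T] T(3) unfolding B\<^sub>0_def plane_lift_def T(2)
    by (simp add: T_def matrix_add_ldistrib matrix_add_rdistrib matrix_mul_assoc invertible_det_nz)
  note Astar = KL_affine_minimal_of_whitened[OF T(3) u z B\<^sub>0_minimal, unfolded this, folded T(1)]
  show ?thesis
    apply (rule exI[of _ d1], rule exI[of _ 1])
    \<comment> \<open>fold V before c and c before A2: each definition mentions the previous one\<close>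
    unfolding Let_def V_def[symmetric]
    unfolding c_def[symmetric]
    unfolding A2_def[symmetric] plane_frame_def[symmetric]
    using Astar by (auto simp: assms(5) d1_def matrix_vector_mult_diff_distrib)
qed

end
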